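(* Let $s_1,s_2,s_3\ge 3$ be integers. Then $$R(K_{2s_1-1}^{(3)}-e,\ K_{2s_2-1}^{(3)},\ K_{2s_3-1}^{(3)};3)\ \ge\ R(K_{s_1},K_{s_2},K_{s_3};2).$$
   Context: $K_m^{(r)}$ denotes the complete $r$-uniform hypergraph on $m$ vertices ($K_m=K_m^{(2)}$), and $K_m^{(3)}-e$ denotes $K_m^{(3)}$ with one hyperedge removed. For $r$-uniform hypergraphs $H_1,\dots,H_t$, the Ramsey number $R(H_1,\dots,H_t;r)$ is the least positive integer $p$ such that every coloring of the hyperedges of $K_p^{(r)}$ with colors $1,\dots,t$ contains, for some $i$, a subhypergraph isomorphic to $H_i$ all of whose hyperedges have color $i$. *)

theory Defs
  imports "HOL-Library.Ramsey"
begin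

text \<open>A hypergraph is a pair of a vertex set and a set of hyperedges. The notation
  \<open>[V]\<^bsup>r\<^esup>\<close> is the library's set of \<open>r\<close>-element subsets of \<open>V\<close>.\<close>

type_synonym 'a hypergraph = "'a set \<times> 'a set set"

abbreviation verts :: "'a hypergraph \<Rightarrow> 'a set" where
  "verts H \<equiv> fst H"

abbreviation hedges :: "'a hypergraph \<Rightarrow> 'a set set" where
  "hedges H \<equiv> snd H"

definition complete_hypergraph :: "nat \<Rightarrow> nat \<Rightarrow> nat hypergraph" where
  "complete_hypergraph r m = ({..<m}, [{..<m}]\<^bsup>r\<^esup>)"

definition delete_hedge :: "'a hypergraph \<Rightarrow> 'a set \<Rightarrow> 'a hypergraph" where
  "delete_hedge H e = (verts H, hedges H - {e})"

definition subhypergraph :: "'a hypergraph \<Rightarrow> 'a hypergraph \<Rightarrow> bool" where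
  "subhypergraph S H \<longleftrightarrow>
     verts S \<subseteq> verts H \<and> hedges S \<subseteq> hedges H \<and> (\<forall>e\<in>hedges S. e \<subseteq> verts S)"

definition isomorphic_hypergraphs :: "'a hypergraph \<Rightarrow> 'b hypergraph \<Rightarrow> bool" where
  "isomorphic_hypergraphs G H \<longleftrightarrow>
     (\<exists>f. bij_betw f (verts G) (verts H) \<and> hedges H = (\<lambda>e. f ` e) ` hedges G)"

text \<open>The hypergraphs are given as a list, and the colours are the list positions, so
  they run over \<open>0, \<dots>, t - 1\<close> instead of \<open>1, \<dots>, t\<close>.\<close>

definition ramsey_property :: "nat \<Rightarrow> 'a hypergraph list \<Rightarrow> nat \<Rightarrow> bool" where
  "ramsey_property r Hs p \<longleftrightarrow>
     (\<forall>c \<in> hedges (complete_hypergraph r p) \<rightarrow> {..<length Hs}.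
        \<exists>i<length Hs. \<exists>S. subhypergraph S (complete_hypergraph r p) \<and>
          isomorphic_hypergraphs S (Hs ! i) \<and> (\<forall>e\<in>hedges S. c e = i))"

definition ramsey_number :: "nat \<Rightarrow> 'a hypergraph list \<Rightarrow> nat" where
  "ramsey_number r Hs = (LEAST p. 0 < p \<and> ramsey_property r Hs p)"

end

theory Submission
  imports Defs
begin

text \<open>
  Given a colouring \<open>c\<close> of pairs, colour a triple \<open>x < y < z\<close> by \<open>c {x, y}\<close> if this is
  nonzero and by \<open>c {y, z}\<close> otherwise. A triple of colour \<open>0\<close> then has both consecutive pairs of
  colour \<open>0\<close>, and a triple of colour \<open>k > 0\<close> has at least one consecutive pair of colour \<open>k\<close>.

  If all triples of \<open>V\<close> but one have colour \<open>0\<close>, then prepending the least vertex of \<open>V\<close> to a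
  pair shows that every pair in \<open>V\<close> avoiding that vertex has colour \<open>0\<close>, with one possible
  exception; deleting two vertices leaves a clique of size \<open>2 s - 3 \<ge> s\<close>. If all triples of \<open>V\<close>
  have colour \<open>k > 0\<close>, then there are no \<open>x < y < z\<close> with both \<open>{x, y}\<close> and \<open>{y, z}\<close> of
  colour different from \<open>k\<close>. So the vertices having a smaller neighbour in a colour other than \<open>k\<close>
  form a clique of colour \<open>k\<close>, and so do the remaining ones; one of the two has at least \<open>s\<close> of
  the \<open>2 s - 1\<close> vertices.
\<close>

text \<open>Guarantees that the \<open>LEAST\<close> in \<open>ramsey_number\<close> is attained.
  Ramsey's theorem for complete hypergraphs suffices, because a monochromatic clique on as many
  vertices as a hypergraph contains a copy of it.\<close>

lemma ramsey_property_exists: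
  assumes "\<And>H. H \<in> set Hs \<Longrightarrow> finite (verts H) \<and> hedges H \<subseteq> [verts H]\<^bsup>r\<^esup>"
  shows "\<exists>p>0. ramsey_property r Hs p"
proof -
  let ?qs = "map (\<lambda>H. card (verts H)) Hs"
  obtain N :: nat where "partn_lst {..<N} ?qs r"
    using ramsey_full by blast
  \<comment> \<open>Passing from \<open>N\<close> to \<open>Suc N\<close> secures the required
    positivity.\<close>
  then have N: "partn_lst {..<Suc N} ?qs r"
    by (rule partn_lst_greater_resource) simp
  have "ramsey_property r Hs (Suc N)"
    unfolding ramsey_property_def
  proof
    fix c assume "c \<in> hedges (complete_hypergraph r (Suc N)) \<rightarrow> {..<length Hs}"
    then have "c \<in> [{..<Suc N}]\<^bsup>r\<^esup> \<rightarrow> {..<length Hs}"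
      by (simp add: complete_hypergraph_def)
    from partn_lstE[OF N this] obtain i U where i: "i < length Hs"
      and U: "U \<in> [{..<Suc N}]\<^bsup>card (verts (Hs ! i))\<^esup>" and mono: "c ` [U]\<^bsup>r\<^esup> \<subseteq> {i}"
      by auto
    let ?H = "Hs ! i"
    have H: "finite (verts ?H)" "hedges ?H \<subseteq> [verts ?H]\<^bsup>r\<^esup>"
      using assms i by auto
    obtain g where g: "bij_betw g U (verts ?H)"
      using U H finite_same_card_bij[of U "verts ?H"] by (auto simp: nsets_def)
    \<comment> \<open>The hyperedges of \<open>?H\<close> are pulled back along \<open>g\<close>
      into the monochromatic clique on \<open>U\<close>.\<close>
    define S where "S = (U, {e \<in> [U]\<^bsup>r\<^esup>. g ` e \<in> hedges ?H})"
    have "subhypergraph S (complete_hypergraph r (Suc N))"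
      using U by (auto simp: S_def subhypergraph_def complete_hypergraph_def nsets_def)
    moreover have "hedges ?H = (\<lambda>e. g ` e) ` hedges S"
    proof
      show "hedges ?H \<subseteq> (\<lambda>e. g ` e) ` hedges S"
      proof
        fix x assume x: "x \<in> hedges ?H"
        then have "x \<in> (\<lambda>e. g ` e) ` [U]\<^bsup>r\<^esup>"
          using H(2) bij_betw_imp_surj_on[OF bij_betw_nsets[OF g, of r]] by auto
        then show "x \<in> (\<lambda>e. g ` e) ` hedges S"
          using x by (auto simp: S_def)
      qed
    qed (auto simp: S_def)
    then have "isomorphic_hypergraphs S ?H"
      using g by (auto simp: isomorphic_hypergraphs_def S_def)
    moreover have "\<forall>e\<in>hedges S. c e = i"
      using mono by (auto simp: S_def)
    ultimately show "\<exists>i<length Hs. \<exists>S. subhypergraph S (complete_hypergraph r (Suc N)) \<and>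
        isomorphic_hypergraphs S (Hs ! i) \<and> (\<forall>e\<in>hedges S. c e = i)"
      using i by blast
  qed
  then show ?thesis by blast
qed

text \<open>A bijection onto \<open>{..<m}\<close> induces one between the \<open>r\<close>-subsets,
  and taking images is injective on subsets of \<open>verts S\<close>, so equal images force equal
  sets of hyperedges.\<close>

lemma isomorphic_complete_hypergraph_iff:
  assumes "\<forall>e\<in>hedges S. e \<subseteq> verts S"
  shows "isomorphic_hypergraphs S (complete_hypergraph r m) \<longleftrightarrow>
    finite (verts S) \<and> card (verts S) = m \<and> hedges S = [verts S]\<^bsup>r\<^esup>"
proof
  assume "isomorphic_hypergraphs S (complete_hypergraph r m)"
  then obtain f where f: "bij_betw f (verts S) {..<m}"
    and E: "[{..<m}]\<^bsup>r\<^esup> = (\<lambda>e. f ` e) ` hedges S"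
    by (auto simp: isomorphic_hypergraphs_def complete_hypergraph_def)
  have "(\<lambda>e. f ` e) ` hedges S = (\<lambda>e. f ` e) ` [verts S]\<^bsup>r\<^esup>"
    using E bij_betw_imp_surj_on[OF bij_betw_nsets[OF f, of r]] by simp
  moreover have "hedges S \<subseteq> Pow (verts S)" "[verts S]\<^bsup>r\<^esup> \<subseteq> Pow (verts S)"
    using assms by (auto simp: nsets_def)
  ultimately have "hedges S = [verts S]\<^bsup>r\<^esup>"
    by (simp add: inj_on_image_eq_iff[OF inj_on_image_Pow[OF bij_betw_imp_inj_on[OF f]]])
  then show "finite (verts S) \<and> card (verts S) = m \<and> hedges S = [verts S]\<^bsup>r\<^esup>"
    using bij_betw_finite[OF f] bij_betw_same_card[OF f] by simp
next
  assume S: "finite (verts S) \<and> card (verts S) = m \<and> hedges S = [verts S]\<^bsup>r\<^esup>"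
  then obtain f where f: "bij_betw f (verts S) {..<m}"
    by (metis card_lessThan finite_lessThan finite_same_card_bij)
  then show "isomorphic_hypergraphs S (complete_hypergraph r m)"
    using S bij_betw_imp_surj_on[OF bij_betw_nsets[OF f, of r]]
    by (auto simp: isomorphic_hypergraphs_def complete_hypergraph_def)
qed

text \<open>Transports the missing hyperedge back to \<open>verts S\<close>. For
  \<open>r = 3\<close> the inclusion has the form that the clique argument uses: all triples but at
  most one are hyperedges.\<close>

lemma isomorphic_delete_hedge_complete_hypergraph:
  assumes "\<forall>e\<in>hedges S. e \<subseteq> verts S"
    and "isomorphic_hypergraphs S (delete_hedge (complete_hypergraph r m) d)"
  obtains d' where "finite (verts S)" "card (verts S) = m" "[verts S]\<^bsup>r\<^esup> - {d'} \<subseteq> hedges S"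
proof -
  obtain f where f: "bij_betw f (verts S) {..<m}"
    and E: "[{..<m}]\<^bsup>r\<^esup> - {d} = (\<lambda>e. f ` e) ` hedges S"
    using assms(2)
    by (auto simp: isomorphic_hypergraphs_def complete_hypergraph_def delete_hedge_def)
  have inj: "inj_on (\<lambda>e. f ` e) (Pow (verts S))"
    using bij_betw_imp_inj_on[OF f] by (rule inj_on_image_Pow)
  \<comment> \<open>This preimage is the only subset of \<open>verts S\<close> that \<open>f\<close>
    can map onto \<open>d\<close>.\<close>
  define d' where "d' = {v \<in> verts S. f v \<in> d}"
  have "e \<in> hedges S" if e: "e \<in> [verts S]\<^bsup>r\<^esup>" "e \<noteq> d'" for e
  proof -
    have sub: "e \<subseteq> verts S"
      using e by (simp add: nsets_def)
    have "f ` e \<noteq> d"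
    proof
      assume "f ` e = d"
      then have "d' = e"
        using sub inj_on_image_mem_iff[OF bij_betw_imp_inj_on[OF f] _ sub]
        by (auto simp: d'_def)
      with e show False by simp
    qed
    moreover have "f ` e \<in> [{..<m}]\<^bsup>r\<^esup>"
      using bij_betw_imp_surj_on[OF bij_betw_nsets[OF f, of r]] e by blast
    ultimately have "f ` e \<in> (\<lambda>e. f ` e) ` hedges S"
      unfolding E[symmetric] by simp
    then obtain e' where e': "e' \<in> hedges S" "f ` e = f ` e'"
      by (rule imageE)
    then have "e = e'"
      using sub assms(1) by (intro inj_onD[OF inj]) auto
    with e' show ?thesis by simp
  qed
  then have "[verts S]\<^bsup>r\<^esup> - {d'} \<subseteq> hedges S" by blast
  moreover have "finite (verts S)" "card (verts S) = m"
    using bij_betw_finite[OF f] bij_betw_same_card[OF f] by simp_all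
  ultimately show ?thesis using that by blast
qed

text \<open>Surplus vertices are discarded, so a clique that is merely large enough yields an exact
  copy.\<close>

lemma monochromatic_complete_hypergraphI:
  assumes "finite U" "U \<subseteq> {..<p}" "s \<le> card U" and "\<forall>e\<in>[U]\<^bsup>r\<^esup>. c e = i"
  shows "\<exists>S. subhypergraph S (complete_hypergraph r p) \<and>
    isomorphic_hypergraphs S (complete_hypergraph r s) \<and> (\<forall>e\<in>hedges S. c e = i)"
proof -
  obtain W where W: "W \<subseteq> U" "card W = s" "finite W"
    using assms(3) obtain_subset_with_card_n by metis
  then have sub: "[W]\<^bsup>r\<^esup> \<subseteq> [U]\<^bsup>r\<^esup>" "[W]\<^bsup>r\<^esup> \<subseteq> [{..<p}]\<^bsup>r\<^esup>"
    using assms(2) by (auto intro!: nsets_mono)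
  have "\<forall>e\<in>[W]\<^bsup>r\<^esup>. e \<subseteq> W"
    by (simp add: nsets_def)
  then show ?thesis
    using W sub assms
    by (intro exI[of _ "(W, [W]\<^bsup>r\<^esup>)"] conjI)
      (auto simp: isomorphic_complete_hypergraph_iff subhypergraph_def
        complete_hypergraph_def[of r p])
qed

definition triple_colouring :: "(nat set \<Rightarrow> nat) \<Rightarrow> nat set \<Rightarrow> nat" where
  "triple_colouring c t =
    (let xs = sorted_list_of_set t; k = c {xs ! 0, xs ! 1}
     in if k \<noteq> 0 then k else c {xs ! 1, xs ! 2})"

lemma triple_colouring_eq:
  assumes "x < y" "y < z"
  shows "triple_colouring c {x, y, z} = (if c {x, y} \<noteq> 0 then c {x, y} else c {y, z})"
proof -
  have "sorted_list_of_set {x, y, z} = [x, y, z]"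
    using assms by (intro sorted_list_of_set_unique[THEN iffD1]) auto
  then show ?thesis by (simp add: triple_colouring_def Let_def)
qed

lemma triple_colouring_funcset:
  assumes "c \<in> [A]\<^bsup>2\<^esup> \<rightarrow> B"
  shows "triple_colouring c \<in> [A]\<^bsup>3\<^esup> \<rightarrow> B"
proof
  fix t assume "t \<in> [A]\<^bsup>3\<^esup>"
  then obtain x y z where t: "t = {x, y, z}" "x \<in> A" "y \<in> A" "z \<in> A" "x < y" "y < z"
    unfolding ordered_nsets_3_eq by blast
  then have "{x, y} \<in> [A]\<^bsup>2\<^esup>" "{y, z} \<in> [A]\<^bsup>2\<^esup>" by auto
  then have "c {x, y} \<in> B" "c {y, z} \<in> B" using assms by blast+
  then show "triple_colouring c t \<in> B"
    using t by (simp add: triple_colouring_eq)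
qed

lemma clique_of_triple_colouring_zero:
  assumes V: "finite V" "card V = 2 * s - 1" "3 \<le> s"
    and col: "\<And>t. t \<in> [V]\<^bsup>3\<^esup> \<Longrightarrow> t \<noteq> d \<Longrightarrow> triple_colouring c t = 0"
  shows "\<exists>U\<subseteq>V. s \<le> card U \<and> (\<forall>e\<in>[U]\<^bsup>2\<^esup>. c e = 0)"
proof -
  define m where "m = Min V"
  have "V \<noteq> {}" using V by auto
  then have m: "m \<in> V" "\<And>v. v \<in> V \<Longrightarrow> m \<le> v"
    using V by (auto simp: m_def)
  \<comment> \<open>If \<open>d\<close> has a vertex other than \<open>m\<close>, then
    \<open>w\<close> is one, and a triple avoiding \<open>w\<close> differs from \<open>d\<close>.
    Otherwise \<open>w\<close> is arbitrary, and \<open>d\<close> is too small to be a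
    triple.\<close>
  obtain w where w: "d \<subseteq> {m} \<or> w \<in> d - {m}" by blast
  define U where "U = V - {m, w}"
  have "card V - card {m, w} \<le> card U"
    unfolding U_def by (rule diff_card_le_card_Diff) simp
  moreover have "card {m, w} \<le> 2" by (simp add: card_insert_if)
  ultimately have "s \<le> card U" using V by linarith
  moreover have "\<forall>e\<in>[U]\<^bsup>2\<^esup>. c e = 0"
  proof
    fix e assume "e \<in> [U]\<^bsup>2\<^esup>"
    then obtain x y where e: "e = {x, y}" "x \<in> U" "y \<in> U" "x < y"
      unfolding ordered_nsets_2_eq by blast
    then have "m < x" using m by (force simp: U_def order.strict_iff_order)
    have "{m, x, y} \<in> [V]\<^bsup>3\<^esup>"
      using m e \<open>m < x\<close> unfolding ordered_nsets_3_eq U_def by blast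
    moreover have "{m, x, y} \<noteq> d"
      using w e by (auto simp: U_def)
    ultimately have "triple_colouring c {m, x, y} = 0" by (rule col)
    then show "c e = 0"
      using e \<open>m < x\<close> by (auto simp: triple_colouring_eq split: if_splits)
  qed
  ultimately show ?thesis unfolding U_def by blast
qed

lemma clique_of_triple_colouring_nonzero:
  assumes V: "finite V" "card V = 2 * s - 1" "0 < s" and "k \<noteq> 0"
    and col: "\<And>t. t \<in> [V]\<^bsup>3\<^esup> \<Longrightarrow> triple_colouring c t = k"
  shows "\<exists>U\<subseteq>V. s \<le> card U \<and> (\<forall>e\<in>[U]\<^bsup>2\<^esup>. c e = k)"
proof -
  define A where "A = {v \<in> V. \<exists>u\<in>V. u < v \<and> c {u, v} \<noteq> k}"
  have A: "c e = k" if e: "e \<in> [A]\<^bsup>2\<^esup>" for e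
  proof -
    obtain x y where e: "e = {x, y}" "x \<in> A" "y \<in> A" "x < y"
      using e unfolding ordered_nsets_2_eq by blast
    then obtain u where u: "u \<in> V" "u < x" "c {u, x} \<noteq> k"
      by (auto simp: A_def)
    have "{u, x, y} \<in> [V]\<^bsup>3\<^esup>"
      using u e unfolding ordered_nsets_3_eq A_def by blast
    then have "triple_colouring c {u, x, y} = k" by (rule col)
    \<comment> \<open>A nonzero \<open>c {u, x}\<close> would be the colour of the triple, yet it
      differs from \<open>k\<close>. So \<open>c {u, x}\<close> is \<open>0\<close> and the colour
      \<open>k\<close> comes from \<open>{x, y}\<close>.\<close>
    then show ?thesis
      using e u by (auto simp: triple_colouring_eq split: if_splits)
  qed
  \<comment> \<open>For \<open>x < y\<close> outside \<open>A\<close>, a colour of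
    \<open>{x, y}\<close> other than \<open>k\<close> would make \<open>x\<close> a witness for
    \<open>y\<close> being in \<open>A\<close>.\<close>
  have B: "c e = k" if "e \<in> [V - A]\<^bsup>2\<^esup>" for e
    using that unfolding ordered_nsets_2_eq A_def by blast
  have "card V = card A + card (V - A)"
    using V card_Int_Diff[of V A] by (simp add: A_def Int_absorb1 Collect_conj_eq)
  then have "s \<le> card A \<or> s \<le> card (V - A)" using V by linarith
  moreover have "A \<subseteq> V" by (auto simp: A_def)
  ultimately show ?thesis using A B by (meson Diff_subset)
qed

theorem theorem12:
  fixes s1 s2 s3 :: nat and e :: "nat set"
  assumes "3 \<le> s1" and "3 \<le> s2" and "3 \<le> s3"
    and "e \<in> hedges (complete_hypergraph 3 (2 * s1 - 1))"
  shows "ramsey_number 3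
           [delete_hedge (complete_hypergraph 3 (2 * s1 - 1)) e,
            complete_hypergraph 3 (2 * s2 - 1),
            complete_hypergraph 3 (2 * s3 - 1)]
         \<ge> ramsey_number 2
             [complete_hypergraph 2 s1, complete_hypergraph 2 s2, complete_hypergraph 2 s3]"
proof -
  let ?Hs = "[delete_hedge (complete_hypergraph 3 (2 * s1 - 1)) e,
    complete_hypergraph 3 (2 * s2 - 1), complete_hypergraph 3 (2 * s3 - 1)]"
  let ?ss = "[s1, s2, s3]"
  let ?Gs = "[complete_hypergraph 2 s1, complete_hypergraph 2 s2, complete_hypergraph 2 s3]"
  define p where "p = ramsey_number 3 ?Hs"
  have "\<exists>p>0. ramsey_property 3 ?Hs p"
    by (rule ramsey_property_exists) (auto simp: complete_hypergraph_def delete_hedge_def)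
  then have p: "0 < p \<and> ramsey_property 3 ?Hs p"
    unfolding p_def ramsey_number_def by (rule LeastI_ex)
  \<comment> \<open>By minimality it is enough that the Ramsey number for triples has the Ramsey
    property for pairs.\<close>
  have "ramsey_property 2 ?Gs p"
    unfolding ramsey_property_def
  proof
    fix c assume "c \<in> hedges (complete_hypergraph 2 p) \<rightarrow> {..<length ?Gs}"
    then have "triple_colouring c \<in> hedges (complete_hypergraph 3 p) \<rightarrow> {..<length ?Hs}"
      using triple_colouring_funcset[of c "{..<p}" "{..<3}"]
      by (simp add: complete_hypergraph_def numeral_3_eq_3)
    then obtain i S where i: "i < length ?Hs" and S: "subhypergraph S (complete_hypergraph 3 p)"
      and iso: "isomorphic_hypergraphs S (?Hs ! i)"
      and col: "\<And>t. t \<in> hedges S \<Longrightarrow> triple_colouring c t = i"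
      using p unfolding ramsey_property_def by blast
    have sub: "\<forall>e\<in>hedges S. e \<subseteq> verts S"
      using S by (simp add: subhypergraph_def)
    have "\<exists>U\<subseteq>verts S. ?ss ! i \<le> card U \<and> (\<forall>e\<in>[U]\<^bsup>2\<^esup>. c e = i)"
    \<comment> \<open>The hypergraph lacking a hyperedge stands at position \<open>0\<close>, the
      colour that \<open>triple_colouring\<close> assigns only if both consecutive pairs have it;
      this strictness makes up for the missing triple.\<close>
    proof (cases "i = 0")
      case True
      then have "isomorphic_hypergraphs S (delete_hedge (complete_hypergraph 3 (2 * s1 - 1)) e)"
        using iso by simp
      then obtain d where "finite (verts S)" "card (verts S) = 2 * s1 - 1"
        "[verts S]\<^bsup>3\<^esup> - {d} \<subseteq> hedges S"
        using isomorphic_delete_hedge_complete_hypergraph[OF sub] by blast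
      then show ?thesis
        using clique_of_triple_colouring_zero[of "verts S" s1 d c] col assms(1) True by auto
    next
      case False
      then have "isomorphic_hypergraphs S (complete_hypergraph 3 (2 * ?ss ! i - 1))"
        and pos: "0 < ?ss ! i"
        using iso i assms by (auto simp: less_Suc_eq)
      then have "finite (verts S)" "card (verts S) = 2 * ?ss ! i - 1" "hedges S = [verts S]\<^bsup>3\<^esup>"
        using isomorphic_complete_hypergraph_iff[OF sub] by auto
      then show ?thesis
        using clique_of_triple_colouring_nonzero[of "verts S" "?ss ! i" i c] col pos False by auto
    qed
    then obtain U where U: "U \<subseteq> verts S" "?ss ! i \<le> card U" "\<forall>e\<in>[U]\<^bsup>2\<^esup>. c e = i" by blast
    moreover from U(1) S have Up: "U \<subseteq> {..<p}"
      by (auto simp: subhypergraph_def complete_hypergraph_def)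
    moreover have "?Gs ! i = complete_hypergraph 2 (?ss ! i)"
      using i by (auto simp: less_Suc_eq)
    ultimately show "\<exists>i<length ?Gs. \<exists>S. subhypergraph S (complete_hypergraph 2 p) \<and>
        isomorphic_hypergraphs S (?Gs ! i) \<and> (\<forall>e\<in>hedges S. c e = i)"
      using monochromatic_complete_hypergraphI[of U p "?ss ! i" 2 c i] i
        finite_subset[OF Up finite_lessThan]
      by (intro exI[of _ i]) simp
  qed
  then have "ramsey_number 2 ?Gs \<le> p"
    using p unfolding ramsey_number_def by (intro Least_le) simp
  then show ?thesis by (simp add: p_def)
qed

end
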